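(* Let $G=(V,E)$ be a connected locally finite graph with symmetric positive edge weights $\omega_{xy}=\omega_{yx}>0$ ($xy\in E$) and measure $\mu:V\to(0,\infty)$ with $\mu(x)\ge\mu_{\min}>0$ for all $x\in V$. Assume $a:V\to\mathbb{R}$ satisfies: $(A_1)$ $\inf_{x\in V}a(x)\ge a_0$ for some constant $a_0\in(-1,0)$; $(A_2)$ for every $M>0$, the set $D_M=\{x\in V: a(x)\le M\}$ has finite volume, i.e. $\sum_{x\in D_M}\mu(x)<\infty$. Then $\mathcal H$ is weakly pre-compact (every bounded sequence in $\mathcal H$ has a subsequence converging weakly to an element of $\mathcal H$), and $\mathcal H$ is compactly embedded into $L^p(V)$ for all $2\le p\le+\infty$.
   Context: A graph is locally finite if every vertex has finitely many neighbours; write $y\sim x$ if $xy\in E$. For $u,v:V\to\mathbb{R}$: $\int_V u\,d\mu=\sum_{x\in V}\mu(x)u(x)$; $\Gamma(u,v)(x)=\frac1{2\mu(x)}\sum_{y\sim x}\omega_{xy}(u(y)-u(x))(v(y)-v(x))$; $|\nabla u|^2=\Gamma(u,u)$. $L^p(V)$ has norm $\left(\int_V|u|^p\,d\mu\right)^{1/p}$ for $1\le p<\infty$ and $\sup_{x\in V}|u(x)|$ for $p=\infty$. $C_c(V)$ is the set of functions with finite support, and $H^1(V)$ is the completion of $C_c(V)$ under $\|u\|_{H^1(V)}=\left(\int_V(|\nabla u|^2+u^2)\,d\mu\right)^{1/2}$ (regarded as a space of functions on $V$). $\mathcal H=\{u\in H^1(V):\int_V a(x)u^2\,d\mu<+\infty\}$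 is the Hilbert space with inner product $\langle u,v\rangle_{\mathcal H}=\int_V(\Gamma(u,v)+(a(x)+1)uv)\,d\mu$ and induced norm $\|\cdot\|_{\mathcal H}$. *)

theory Defs
  imports "HOL-Analysis.Analysis"
begin

text \<open>
  The vertex set \<open>V\<close> is a whole type \<open>'v\<close>; the edge set is a symmetric relation
  \<open>E\<close> on it, with both \<open>(x, y)\<close> and \<open>(y, x)\<close> representing the edge \<open>xy\<close>. Loops are
  not excluded; they contribute nothing to \<open>\<Gamma>\<close>.
\<close>

definition locally_finite_graph :: "('v \<times> 'v) set \<Rightarrow> bool" where
  "locally_finite_graph E \<longleftrightarrow> (\<forall>x. finite (E `` {x}))"

definition connected_graph :: "('v \<times> 'v) set \<Rightarrow> bool" where
  "connected_graph E \<longleftrightarrow> (\<forall>x y. (x, y) \<in> E\<^sup>*)"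

text \<open>
  On the reals, \<open>summable_on\<close> is absolute summability, so \<open>vintegrable\<close> is integrability
  with respect to \<open>\<mu>\<close>; \<open>vint\<close> is 0 (not \<open>\<infinity>\<close>) outside the integrable functions.
\<close>

definition vintegrable :: "('v \<Rightarrow> real) \<Rightarrow> ('v \<Rightarrow> real) \<Rightarrow> bool" where
  "vintegrable \<mu> u \<longleftrightarrow> (\<lambda>x. \<mu> x * u x) summable_on UNIV"

definition vint :: "('v \<Rightarrow> real) \<Rightarrow> ('v \<Rightarrow> real) \<Rightarrow> real" where
  "vint \<mu> u = (\<Sum>\<^sub>\<infinity>x. \<mu> x * u x)"

definition Gam ::
  "('v \<times> 'v) set \<Rightarrow> ('v \<Rightarrow> 'v \<Rightarrow> real) \<Rightarrow> ('v \<Rightarrow> real)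
    \<Rightarrow> ('v \<Rightarrow> real) \<Rightarrow> ('v \<Rightarrow> real) \<Rightarrow> 'v \<Rightarrow> real" where
  "Gam E \<omega> \<mu> u v x =
     1 / (2 * \<mu> x) * (\<Sum>y\<in>E `` {x}. \<omega> x y * (u y - u x) * (v y - v x))"

definition Cc :: "('v \<Rightarrow> real) set" where
  "Cc = {u. finite {x. u x \<noteq> 0}}"

definition H1_norm ::
  "('v \<times> 'v) set \<Rightarrow> ('v \<Rightarrow> 'v \<Rightarrow> real) \<Rightarrow> ('v \<Rightarrow> real) \<Rightarrow> ('v \<Rightarrow> real) \<Rightarrow> real" where
  "H1_norm E \<omega> \<mu> u = sqrt (vint \<mu> (\<lambda>x. Gam E \<omega> \<mu> u u x + (u x)\<^sup>2))"

text \<open>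
  The completion of \<open>Cc\<close>, realised as a space of functions: a class of Cauchy sequences
  is identified with its pointwise limit. When \<open>\<mu>\<close> is bounded below by a positive
  constant, point evaluations are continuous for \<open>H1_norm\<close>, so the limit exists, and it
  determines the class.
\<close>

definition H1 ::
  "('v \<times> 'v) set \<Rightarrow> ('v \<Rightarrow> 'v \<Rightarrow> real) \<Rightarrow> ('v \<Rightarrow> real) \<Rightarrow> ('v \<Rightarrow> real) set" where
  "H1 E \<omega> \<mu> = {u. \<exists>\<phi> :: nat \<Rightarrow> 'v \<Rightarrow> real.
      (\<forall>n. \<phi> n \<in> Cc) \<and>
      (\<forall>e>0. \<exists>N. \<forall>m\<ge>N. \<forall>n\<ge>N. H1_norm E \<omega> \<mu> (\<lambda>x. \<phi> m x - \<phi> n x) < e) \<and>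
      (\<forall>x. (\<lambda>n. \<phi> n x) \<longlonglongrightarrow> u x)}"

text \<open>
  If \<open>a\<close> is bounded below, the negative part of \<open>a u\<^sup>2\<close> is integrable for every
  \<open>u \<in> H1\<close>, so integrability of \<open>a u\<^sup>2\<close> says exactly that its integral, which always
  exists in \<open>(-\<infinity>, \<infinity>]\<close>, is less than \<open>\<infinity>\<close>.
\<close>

definition Hsp ::
  "('v \<times> 'v) set \<Rightarrow> ('v \<Rightarrow> 'v \<Rightarrow> real) \<Rightarrow> ('v \<Rightarrow> real) \<Rightarrow> ('v \<Rightarrow> real)
    \<Rightarrow> ('v \<Rightarrow> real) set" where
  "Hsp E \<omega> \<mu> a = {u \<in> H1 E \<omega> \<mu>. vintegrable \<mu> (\<lambda>x. a x * (u x)\<^sup>2)}"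

definition Hsp_inner ::
  "('v \<times> 'v) set \<Rightarrow> ('v \<Rightarrow> 'v \<Rightarrow> real) \<Rightarrow> ('v \<Rightarrow> real) \<Rightarrow> ('v \<Rightarrow> real)
    \<Rightarrow> ('v \<Rightarrow> real) \<Rightarrow> ('v \<Rightarrow> real) \<Rightarrow> real" where
  "Hsp_inner E \<omega> \<mu> a u v = vint \<mu> (\<lambda>x. Gam E \<omega> \<mu> u v x + (a x + 1) * u x * v x)"

definition Hsp_norm ::
  "('v \<times> 'v) set \<Rightarrow> ('v \<Rightarrow> 'v \<Rightarrow> real) \<Rightarrow> ('v \<Rightarrow> real) \<Rightarrow> ('v \<Rightarrow> real)
    \<Rightarrow> ('v \<Rightarrow> real) \<Rightarrow> real" where
  "Hsp_norm E \<omega> \<mu> a u = sqrt (Hsp_inner E \<omega> \<mu> a u u)"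

definition Lp :: "('v \<Rightarrow> real) \<Rightarrow> ereal \<Rightarrow> ('v \<Rightarrow> real) set" where
  "Lp \<mu> p =
     (if p = \<infinity> then {u. bdd_above (range (\<lambda>x. \<bar>u x\<bar>))}
      else {u. vintegrable \<mu> (\<lambda>x. \<bar>u x\<bar> powr real_of_ereal p)})"

definition Lp_norm :: "('v \<Rightarrow> real) \<Rightarrow> ereal \<Rightarrow> ('v \<Rightarrow> real) \<Rightarrow> real" where
  "Lp_norm \<mu> p u =
     (if p = \<infinity> then (SUP x. \<bar>u x\<bar>)
      else vint \<mu> (\<lambda>x. \<bar>u x\<bar> powr real_of_ereal p) powr (1 / real_of_ereal p))"

text \<open>
  Below, \<open>X\<close> and \<open>Y\<close> are linear spaces of functions on \<open>V\<close>, normed by \<open>N\<close> and \<open>N'\<close>.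
\<close>

definition bounded_seq_in ::
  "('v \<Rightarrow> real) set \<Rightarrow> (('v \<Rightarrow> real) \<Rightarrow> real) \<Rightarrow> (nat \<Rightarrow> 'v \<Rightarrow> real) \<Rightarrow> bool" where
  "bounded_seq_in X N s \<longleftrightarrow> (\<forall>k. s k \<in> X) \<and> (\<exists>B. \<forall>k. N (s k) \<le> B)"

definition bounded_functional ::
  "('v \<Rightarrow> real) set \<Rightarrow> (('v \<Rightarrow> real) \<Rightarrow> real) \<Rightarrow> (('v \<Rightarrow> real) \<Rightarrow> real) \<Rightarrow> bool" where
  "bounded_functional X N f \<longleftrightarrow>
     (\<forall>u\<in>X. \<forall>v\<in>X. f (\<lambda>x. u x + v x) = f u + f v) \<and>
     (\<forall>c. \<forall>u\<in>X. f (\<lambda>x. c * u x) = c * f u) \<and>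
     (\<exists>C. \<forall>u\<in>X. \<bar>f u\<bar> \<le> C * N u)"

definition weakly_converges ::
  "('v \<Rightarrow> real) set \<Rightarrow> (('v \<Rightarrow> real) \<Rightarrow> real) \<Rightarrow> (nat \<Rightarrow> 'v \<Rightarrow> real)
    \<Rightarrow> ('v \<Rightarrow> real) \<Rightarrow> bool" where
  "weakly_converges X N s u \<longleftrightarrow>
     (\<forall>f. bounded_functional X N f \<longrightarrow> (\<lambda>k. f (s k)) \<longlonglongrightarrow> f u)"

definition weakly_precompact ::
  "('v \<Rightarrow> real) set \<Rightarrow> (('v \<Rightarrow> real) \<Rightarrow> real) \<Rightarrow> bool" where
  "weakly_precompact X N \<longleftrightarrow>
     (\<forall>s. bounded_seq_in X N s \<longrightarrow>
        (\<exists>(r :: nat \<Rightarrow> nat) u. strict_mono r \<and> u \<in> X \<and> weakly_converges X N (s \<circ> r) u))"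

definition compactly_embedded ::
  "('v \<Rightarrow> real) set \<Rightarrow> (('v \<Rightarrow> real) \<Rightarrow> real)
    \<Rightarrow> ('v \<Rightarrow> real) set \<Rightarrow> (('v \<Rightarrow> real) \<Rightarrow> real) \<Rightarrow> bool" where
  "compactly_embedded X N Y N' \<longleftrightarrow>
     X \<subseteq> Y \<and>
     (\<exists>C. \<forall>u\<in>X. N' u \<le> C * N u) \<and>
     (\<forall>s. bounded_seq_in X N s \<longrightarrow>
        (\<exists>(r :: nat \<Rightarrow> nat) u. strict_mono r \<and> u \<in> Y \<and>
           (\<lambda>k. N' (\<lambda>x. s (r k) x - u x)) \<longlonglongrightarrow> 0))"

end

theory Submission
  imports Defs "HOL-Complex_Analysis.Great_Picard"
begin

text \<open>
  The measure of a point is at least \<open>\<mu>min\<close>, so a set of finite volume is finite: every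
  sublevel set \<open>{x. a x \<le> M}\<close> is finite (\<open>finite_sublevel\<close>). This makes the vertex set countable,
  and it makes both claims consequences of pointwise convergence.

  Since \<open>a + 1 \<ge> 1 + a0 > 0\<close>, the norm of \<open>\<H>\<close> dominates the \<open>H1\<close> norm and the \<open>L2\<close> norm
  up to constants, and the latter dominates point values because of the lower bound on \<open>\<mu>\<close>.
  Hence a bounded sequence in \<open>\<H>\<close> is bounded at each vertex, and a diagonal subsequence converges
  pointwise to some \<open>u\<close> (\<open>bounded_subsequence\<close>).

  The weak convergence comes from a variational choice of averages. Take almost
  norm-minimal elements \<open>w n\<close> in the midpoint-convex hulls of the tails of the sequence. By the
  parallelogram law they form a Cauchy sequence; they still converge pointwise to \<open>u\<close>, so by
  completeness \<open>u \<in> \<H>\<close> and \<open>w n \<longlonglongrightarrow> u\<close> in norm (\<open>midpoint_limit\<close>). A bounded linear functional that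
  is at least \<open>c\<close> along the sequence is at least \<open>c\<close> at every \<open>w n\<close>, hence at \<open>u\<close>. Applied to
  subsequences and to \<open>f\<close> and \<open>- f\<close>, this shows that pointwise convergence of a bounded sequence
  implies weak convergence (\<open>pointwise_imp_weakly_converges\<close>).

  For the compact embedding, let \<open>v n\<close> be bounded in \<open>\<H>\<close> and tend to 0 pointwise. Where \<open>a > M\<close>,
  the \<open>\<H>\<close> energy controls \<open>M\<close> times the mass of \<open>(v n)\<^sup>2\<close>, so that part of the \<open>L2\<close> norm is small
  uniformly in \<open>n\<close> for large \<open>M\<close>; the rest is a finite sum and tends to 0 (\<open>L2_tail\<close>,
  \<open>pointwise_null_imp_L2_null\<close>). Finally \<open>L2\<close> embeds continuously into \<open>Lp\<close> for every \<open>p \<ge> 2\<close>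
  (\<open>Lp_embedding_of_L2\<close>), so smallness in \<open>L2\<close> gives smallness in all of them.

  Completeness of \<open>\<H>\<close> rests on the lower semicontinuity of the energy under pointwise convergence
  (\<open>energy_lower_semicontinuous\<close>), together with the description of \<open>H1\<close> as the functions of finite
  energy that finitely supported functions approximate (\<open>H1_iff_approximable\<close>).
\<close>

section \<open>Quadratic energies\<close>

text \<open>
  The squared norms of \<open>H1\<close> and of \<open>\<H>\<close> are both sums over the vertices of a nonnegative quadratic
  expression in finitely many values of the function. The axioms record this much, so that lower
  semicontinuity and the limits of Cauchy sequences are treated once for both norms. The
  parallelogram law does the work of the inner product.
\<close>

locale quadratic_density =
  fixes q :: "('v \<Rightarrow> real) \<Rightarrow> 'v \<Rightarrow> real"
  assumes nonneg: "0 \<le> q u x"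
    and parallelogram:
      "q (\<lambda>z. u z + v z) x + q (\<lambda>z. u z - v z) x = 2 * q u x + 2 * q v x"
    and scale: "q (\<lambda>z. c * u z) x = c\<^sup>2 * q u x"
    and pointwise_cont:
      "(\<And>z. (\<lambda>n. s n z) \<longlonglongrightarrow> u z) \<Longrightarrow> (\<lambda>n. q (s n) x) \<longlonglongrightarrow> q u x"
begin

definition finite_energy :: "('v \<Rightarrow> real) \<Rightarrow> bool" where
  "finite_energy u \<longleftrightarrow> q u summable_on UNIV"

definition energy :: "('v \<Rightarrow> real) \<Rightarrow> real" where
  "energy u = (\<Sum>\<^sub>\<infinity>x. q u x)"

definition energy_Cauchy :: "(nat \<Rightarrow> 'v \<Rightarrow> real) \<Rightarrow> bool" where
  "energy_Cauchy s \<longleftrightarrow>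
     (\<forall>e>0. \<exists>N. \<forall>m\<ge>N. \<forall>n\<ge>N. energy (\<lambda>x. s m x - s n x) < e)"

lemma energy_nonneg: "0 \<le> energy u"
  unfolding energy_def by (intro infsum_nonneg nonneg)

lemma density_le_energy:
  assumes "finite_energy u"
  shows "q u x \<le> energy u"
  using finite_sum_le_infsum[of "q u" UNIV "{x}"] assms nonneg
  by (simp add: finite_energy_def energy_def)

lemma finite_energy_add:
  assumes "finite_energy u" and "finite_energy v"
  shows "finite_energy (\<lambda>z. u z + v z)"
  unfolding finite_energy_def
proof (rule summable_on_comparison_test)
  show "(\<lambda>x. 2 * q u x + 2 * q v x) summable_on UNIV"
    using assms unfolding finite_energy_def by (intro summable_on_add summable_on_cmult_right)
next
  fix x show "q (\<lambda>z. u z + v z) x \<le> 2 * q u x + 2 * q v x"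
    using parallelogram[of u v x] nonneg[of "\<lambda>z. u z - v z" x] by linarith
qed (rule nonneg)

lemma finite_energy_scale: "finite_energy u \<Longrightarrow> finite_energy (\<lambda>z. c * u z)"
  using summable_on_cmult_right[of "q u" UNIV "c\<^sup>2"] scale[of c u]
  by (simp add: finite_energy_def cong: summable_on_cong)

lemma energy_scale: "energy (\<lambda>z. c * u z) = c\<^sup>2 * energy u"
  by (simp add: energy_def scale infsum_cmult_right')

lemma energy_midpoint: "energy (\<lambda>z. (u z + v z) / 2) = energy (\<lambda>z. u z + v z) / 4"
  using energy_scale[of "1/2" "\<lambda>z. u z + v z"] by (simp add: power2_eq_square)

lemma finite_energy_diff:
  assumes "finite_energy u" and "finite_energy v"
  shows "finite_energy (\<lambda>z. u z - v z)"
  using finite_energy_add[OF assms(1) finite_energy_scale[OF assms(2), of "-1"]] by simp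

lemma energy_parallelogram:
  assumes "finite_energy u" and "finite_energy v"
  shows "energy (\<lambda>z. u z + v z) + energy (\<lambda>z. u z - v z) = 2 * energy u + 2 * energy v"
proof -
  have "energy (\<lambda>z. u z + v z) + energy (\<lambda>z. u z - v z)
      = (\<Sum>\<^sub>\<infinity>x. q (\<lambda>z. u z + v z) x + q (\<lambda>z. u z - v z) x)"
    using finite_energy_add[OF assms] finite_energy_diff[OF assms]
    unfolding energy_def finite_energy_def by (intro infsum_add[symmetric])
  also have "\<dots> = (\<Sum>\<^sub>\<infinity>x. 2 * q u x + 2 * q v x)"
    by (simp add: parallelogram)
  also have "\<dots> = 2 * energy u + 2 * energy v"
    using assms unfolding finite_energy_def energy_def
    by (simp add: infsum_add summable_on_cmult_right infsum_cmult_right')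
  finally show ?thesis .
qed

lemma energy_add_le:
  assumes "finite_energy u" and "finite_energy v"
  shows "energy (\<lambda>z. u z + v z) \<le> 2 * energy u + 2 * energy v"
  using energy_parallelogram[OF assms] energy_nonneg[of "\<lambda>z. u z - v z"] by linarith

lemma energy_diff_le:
  assumes "finite_energy u" and "finite_energy v"
  shows "energy (\<lambda>z. u z - v z) \<le> 2 * energy u + 2 * energy v"
  using energy_parallelogram[OF assms] energy_nonneg[of "\<lambda>z. u z + v z"] by linarith

lemma energy_minus_commute: "energy (\<lambda>z. u z - v z) = energy (\<lambda>z. v z - u z)"
  using energy_scale[of "-1" "\<lambda>z. u z - v z"] by simp

text \<open>
  Fatou's lemma for sums: each partial sum over a finite set of vertices is continuous under
  pointwise convergence, and the energy is the supremum of these partial sums.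
\<close>

lemma energy_lower_semicontinuous:
  assumes lim: "\<And>z. (\<lambda>n. s n z) \<longlonglongrightarrow> u z"
    and ev: "eventually (\<lambda>n. finite_energy (s n) \<and> energy (s n) \<le> B) sequentially"
  shows "finite_energy u" and "energy u \<le> B"
proof -
  have part: "sum (q u) F \<le> B" if "finite F" for F
  proof (rule tendsto_upperbound)
    show "(\<lambda>n. \<Sum>x\<in>F. q (s n) x) \<longlonglongrightarrow> sum (q u) F"
      by (intro tendsto_sum pointwise_cont lim)
    show "eventually (\<lambda>n. (\<Sum>x\<in>F. q (s n) x) \<le> B) sequentially"
      using ev
    proof eventually_elim
      case (elim n)
      have "sum (q (s n)) F \<le> energy (s n)"
        unfolding energy_def using elim that nonneg
        by (intro finite_sum_le_infsum) (auto simp: finite_energy_def)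
      then show ?case using elim by linarith
    qed
  qed simp
  show fin: "finite_energy u"
    unfolding finite_energy_def
    by (rule nonneg_bdd_above_summable_on) (auto intro!: nonneg bdd_aboveI2 part)
  show "energy u \<le> B"
    using fin part unfolding finite_energy_def energy_def
    by (intro infsum_le_finite_sums) auto
qed

text \<open>
  Lower semicontinuity, applied to \<open>s n - s m\<close> with \<open>n\<close> fixed and \<open>m\<close> tending to infinity,
  bounds the energy of \<open>s n - u\<close> by the tolerance in the Cauchy condition.
\<close>

lemma energy_Cauchy_limit:
  assumes fin: "\<And>n. finite_energy (s n)" and C: "energy_Cauchy s"
    and lim: "\<And>z. (\<lambda>n. s n z) \<longlonglongrightarrow> u z"
  shows "finite_energy u" and "(\<lambda>n. energy (\<lambda>z. s n z - u z)) \<longlonglongrightarrow> 0"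
proof -
  have close: "\<exists>N. \<forall>n\<ge>N. finite_energy (\<lambda>z. s n z - u z) \<and> energy (\<lambda>z. s n z - u z) \<le> e"
    if "e > 0" for e
  proof -
    obtain N where N: "\<And>m n. m \<ge> N \<Longrightarrow> n \<ge> N \<Longrightarrow> energy (\<lambda>z. s m z - s n z) < e"
      using C \<open>e > 0\<close> unfolding energy_Cauchy_def by blast
    have "finite_energy (\<lambda>z. s n z - u z) \<and> energy (\<lambda>z. s n z - u z) \<le> e" if "n \<ge> N" for n
    proof -
      have ptw: "(\<lambda>m. s n z - s m z) \<longlonglongrightarrow> s n z - u z" for z
        by (intro tendsto_intros lim)
      have ev: "eventually (\<lambda>m. finite_energy (\<lambda>z. s n z - s m z)
          \<and> energy (\<lambda>z. s n z - s m z) \<le> e) sequentially"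
        using eventually_ge_at_top[of N]
        by eventually_elim (use N[OF that] fin finite_energy_diff in \<open>auto intro: less_imp_le\<close>)
      show ?thesis
        using energy_lower_semicontinuous[OF ptw ev] by blast
    qed
    then show ?thesis by blast
  qed
  obtain n where "finite_energy (\<lambda>z. s n z - u z)"
    using close[of 1] by auto
  from finite_energy_diff[OF fin[of n] this] show "finite_energy u" by simp
  show "(\<lambda>n. energy (\<lambda>z. s n z - u z)) \<longlonglongrightarrow> 0"
  proof (rule LIMSEQ_I)
    fix e :: real assume "0 < e"
    then obtain N where "\<forall>n\<ge>N. energy (\<lambda>z. s n z - u z) \<le> e / 2"
      using close[of "e / 2"] by auto
    with \<open>0 < e\<close> show "\<exists>N. \<forall>n\<ge>N. norm (energy (\<lambda>z. s n z - u z) - 0) < e"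
      by (intro exI[of _ N]) (auto simp: energy_nonneg)
  qed
qed

end

section \<open>Weak limits from near-minimal midpoint averages\<close>

text \<open>
  Plays the part of the convex hull: the parallelogram argument below averages only two elements
  at a time, and half-spaces, balls and the linear space itself are closed under midpoints.
\<close>

inductive_set midpoint_hull :: "('v \<Rightarrow> real) set \<Rightarrow> ('v \<Rightarrow> real) set"
  for S :: "('v \<Rightarrow> real) set" where
  base: "u \<in> S \<Longrightarrow> u \<in> midpoint_hull S"
| midpoint: "u \<in> midpoint_hull S \<Longrightarrow> v \<in> midpoint_hull S
    \<Longrightarrow> (\<lambda>z. (u z + v z) / 2) \<in> midpoint_hull S"

lemma midpoint_hull_mono: "S \<subseteq> T \<Longrightarrow> midpoint_hull S \<subseteq> midpoint_hull T"
proof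
  fix u assume "S \<subseteq> T" "u \<in> midpoint_hull S"
  from this(2,1) show "u \<in> midpoint_hull T"
    by induction (blast intro: midpoint_hull.intros)+
qed

lemma midpoint_hull_tail_tendsto:
  fixes s :: "nat \<Rightarrow> 'v \<Rightarrow> real"
  assumes lim: "(\<lambda>n. s n z) \<longlonglongrightarrow> u z"
    and w: "\<And>n. w n \<in> midpoint_hull (s ` {n..})"
  shows "(\<lambda>n. w n z) \<longlonglongrightarrow> u z"
proof (rule LIMSEQ_I)
  fix e :: real assume "0 < e"
  then obtain N where N: "\<And>n. n \<ge> N \<Longrightarrow> \<bar>s n z - u z\<bar> < e"
    using LIMSEQ_D[OF lim \<open>0 < e\<close>] by auto
  have "\<bar>v z - u z\<bar> < e" if "v \<in> midpoint_hull (s ` {n..})" "n \<ge> N" for v n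
    using that
  proof induction
    case (base v)
    then show ?case using N by auto
  next
    case (midpoint v v')
    then show ?case by (simp add: abs_less_iff field_simps)
  qed
  then show "\<exists>N. \<forall>n\<ge>N. norm (w n z - u z) < e"
    using w by (auto intro!: exI[of _ N])
qed

text \<open>
  Completeness is stated for Cauchy sequences whose pointwise limit is at hand: it is the only
  candidate for the limit in energy, and by \<open>energy_Cauchy_limit\<close> it is one.
\<close>

locale energy_space = quadratic_density q for q :: "('v \<Rightarrow> real) \<Rightarrow> 'v \<Rightarrow> real" +
  fixes X :: "('v \<Rightarrow> real) set"
  assumes finite_energy: "u \<in> X \<Longrightarrow> finite_energy u"
    and add_mem: "u \<in> X \<Longrightarrow> v \<in> X \<Longrightarrow> (\<lambda>z. u z + v z) \<in> X"
    and scale_mem: "u \<in> X \<Longrightarrow> (\<lambda>z. c * u z) \<in> X"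
    and complete: "(\<And>n. s n \<in> X) \<Longrightarrow> energy_Cauchy s
      \<Longrightarrow> (\<And>z. (\<lambda>n. s n z) \<longlonglongrightarrow> u z) \<Longrightarrow> u \<in> X"
begin

lemma diff_mem: "u \<in> X \<Longrightarrow> v \<in> X \<Longrightarrow> (\<lambda>z. u z - v z) \<in> X"
  using add_mem[of u "\<lambda>z. -1 * v z"] scale_mem[of v "-1"] by simp

lemma midpoint_mem: "u \<in> X \<Longrightarrow> v \<in> X \<Longrightarrow> (\<lambda>z. (u z + v z) / 2) \<in> X"
  using scale_mem[OF add_mem, of u v "1/2"] by simp

lemma midpoint_hull_mem:
  assumes "u \<in> midpoint_hull S" and "S \<subseteq> {v \<in> X. energy v \<le> B}"
  shows "u \<in> X \<and> energy u \<le> B"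
  using assms
proof induction
  case (midpoint u v)
  then have mem: "u \<in> X" "v \<in> X" and le: "energy u \<le> B" "energy v \<le> B"
    by blast+
  have "energy (\<lambda>z. (u z + v z) / 2) \<le> B"
    using energy_midpoint[of u v] energy_add_le[OF mem[THEN finite_energy]] le by simp
  with midpoint_mem[OF mem] show ?case ..
qed blast

text \<open>
  The core of the argument, a form of Mazur's lemma that produces the limit at the same time. The
  infimum \<open>d n\<close> of the energy over the hull of the \<open>n\<close>-th tail increases with \<open>n\<close> and is at most
  \<open>B\<close>, so it converges. If \<open>w m\<close> and \<open>w n\<close> with \<open>n \<le> m\<close> are nearly minimal, their midpoint lies in
  the \<open>n\<close>-th hull and has energy at least \<open>d n\<close>; by the parallelogram law this leaves little room
  for the energy of \<open>w m - w n\<close>.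
\<close>

lemma midpoint_limit:
  assumes s: "\<And>n. s n \<in> X" "\<And>n. energy (s n) \<le> B"
    and lim: "\<And>z. (\<lambda>n. s n z) \<longlonglongrightarrow> u z"
  obtains w where "\<And>n. w n \<in> midpoint_hull (s ` {n..})" and "u \<in> X"
    and "(\<lambda>n. energy (\<lambda>z. w n z - u z)) \<longlonglongrightarrow> 0"
proof -
  define K where "K n = midpoint_hull (s ` {n..})" for n :: nat
  have K: "v \<in> X" "energy v \<le> B" if "v \<in> K n" for v n
    using midpoint_hull_mem[of v "s ` {n..}" B] that s unfolding K_def by auto
  have K_ne: "s n \<in> K n" for n
    unfolding K_def by (intro midpoint_hull.base) auto
  have K_anti: "K m \<subseteq> K n" if "n \<le> m" for n m
    unfolding K_def using that by (intro midpoint_hull_mono) auto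
  define d where "d n = Inf (energy ` K n)" for n
  have bdd: "bdd_below (energy ` K n)" for n
    by (rule bdd_belowI2[of _ 0]) (rule energy_nonneg)
  have d_le: "d n \<le> energy v" if "v \<in> K n" for n v
    unfolding d_def using that bdd by (intro cInf_lower) auto
  have "incseq d"
    unfolding d_def using K_ne
    by (intro monoI cInf_superset_mono image_mono K_anti bdd) auto
  moreover have "d n \<le> B" for n
    using d_le[OF K_ne] s(2)[of n] by (rule order_trans)
  ultimately obtain L where dL: "d \<longlonglongrightarrow> L"
    using incseq_convergent by metis
  have "\<exists>v\<in>K n. energy v < d n + inverse (real (Suc n))" for n
    using cInf_lessD[of "energy ` K n" "d n + inverse (real (Suc n))"] K_ne[of n]
    unfolding d_def by auto
  then obtain w where w: "\<And>n. w n \<in> K n"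
    and w_le: "\<And>n. energy (w n) < d n + inverse (real (Suc n))" by metis
  have diff: "energy (\<lambda>z. w m z - w n z)
      \<le> 2 * (d m - d n) + 2 * inverse (real (Suc m)) + 2 * inverse (real (Suc n))" if "n \<le> m" for m n
  proof -
    have mem: "w m \<in> K n" using K_anti[OF that] w by blast
    have "d n \<le> energy (\<lambda>z. (w m z + w n z) / 2)"
      using mem w[of n] unfolding K_def by (intro d_le[unfolded K_def] midpoint_hull.midpoint)
    then have "4 * d n \<le> energy (\<lambda>z. w m z + w n z)"
      by (simp add: energy_midpoint)
    then show ?thesis
      using energy_parallelogram[of "w m" "w n"] finite_energy[OF K(1)[OF w]] w_le[of m] w_le[of n]
      by simp
  qed
  have Cau: "energy_Cauchy w"
    unfolding energy_Cauchy_def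
  proof (intro allI impI)
    fix e :: real assume "0 < e"
    obtain N1 where N1: "\<And>m n. m \<ge> N1 \<Longrightarrow> n \<ge> N1 \<Longrightarrow> dist (d m) (d n) < e / 8"
      using LIMSEQ_imp_Cauchy[OF dL] \<open>0 < e\<close> unfolding Cauchy_def
      by (metis divide_pos_pos zero_less_numeral)
    obtain N2 where N2: "inverse (real (Suc N2)) < e / 8"
      using reals_Archimedean[of "e / 8"] \<open>0 < e\<close> by auto
    have *: "energy (\<lambda>z. w m z - w n z) < e" if "n \<le> m" "max N1 N2 \<le> n" for m n
    proof -
      have "inverse (real (Suc k)) < e / 8" if "N2 \<le> k" for k
      proof -
        have "inverse (real (Suc k)) \<le> inverse (real (Suc N2))"
          using that by (intro le_imp_inverse_le) auto
        with N2 show ?thesis by (rule le_less_trans[rotated])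
      qed
      then have "inverse (real (Suc m)) < e / 8" "inverse (real (Suc n)) < e / 8"
        using that by auto
      moreover have "d m - d n < e / 8" using N1[of m n] that unfolding dist_real_def by linarith
      ultimately have "2 * (d m - d n) + 2 * inverse (real (Suc m)) + 2 * inverse (real (Suc n))
          < 2 * (e / 8) + 2 * (e / 8) + 2 * (e / 8)"
        by (intro add_strict_mono) simp_all
      also have "\<dots> \<le> e" using \<open>0 < e\<close> by simp
      finally show ?thesis using diff[OF that(1)] by (rule le_less_trans[rotated])
    qed
    show "\<exists>N. \<forall>m\<ge>N. \<forall>n\<ge>N. energy (\<lambda>x. w m x - w n x) < e"
      by (metis * energy_minus_commute nat_le_linear)
  qed
  have ptw: "(\<lambda>n. w n z) \<longlonglongrightarrow> u z" for z
    using midpoint_hull_tail_tendsto[of s z u w, OF lim] w unfolding K_def by blast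
  have "u \<in> X"
    by (rule complete[OF K(1)[OF w] Cau ptw])
  moreover have "(\<lambda>n. energy (\<lambda>z. w n z - u z)) \<longlonglongrightarrow> 0"
    by (rule energy_Cauchy_limit(2)[OF finite_energy[OF K(1)[OF w]] Cau ptw])
  ultimately show ?thesis using that w unfolding K_def by blast
qed

text \<open>
  The half-space \<open>{v. c \<le> f v}\<close> is closed under midpoints, so it contains the averages \<open>w n\<close>, which
  converge to \<open>u\<close> in energy, where \<open>f\<close> is continuous.
\<close>

lemma functional_lower_bound_at_limit:
  assumes s: "\<And>n. s n \<in> X" "\<And>n. energy (s n) \<le> B"
    and lim: "\<And>z. (\<lambda>n. s n z) \<longlonglongrightarrow> u z"
    and f: "bounded_functional X (\<lambda>u. sqrt (energy u)) f"
    and ge: "\<And>n. c \<le> f (s n)"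
  shows "c \<le> f u"
proof -
  obtain w where w: "\<And>n. w n \<in> midpoint_hull (s ` {n..})" and u: "u \<in> X"
    and conv: "(\<lambda>n. energy (\<lambda>z. w n z - u z)) \<longlonglongrightarrow> 0"
    using midpoint_limit[OF s lim] by blast
  from f obtain C where add: "\<And>u v. u \<in> X \<Longrightarrow> v \<in> X \<Longrightarrow> f (\<lambda>x. u x + v x) = f u + f v"
    and scale: "\<And>c u. u \<in> X \<Longrightarrow> f (\<lambda>x. c * u x) = c * f u"
    and C: "\<And>u. u \<in> X \<Longrightarrow> \<bar>f u\<bar> \<le> C * sqrt (energy u)"
    unfolding bounded_functional_def by blast
  have half: "v \<in> X \<and> c \<le> f v" if "v \<in> midpoint_hull (range s)" for v
    using that
  proof induction
    case (midpoint v v')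
    then show ?case
      using scale[OF add_mem[of v v'], of "1/2"] add[of v v'] midpoint_mem[of v v'] by simp
  qed (use s(1) ge in auto)
  have w_mem: "w n \<in> X" "c \<le> f (w n)" for n
    using half w[of n] midpoint_hull_mono[of "s ` {n..}" "range s"] by blast+
  have "c - f u \<le> C * sqrt (energy (\<lambda>z. w n z - u z))" for n
  proof -
    have mem: "(\<lambda>z. w n z - u z) \<in> X" by (intro diff_mem w_mem u)
    have "f (w n) = f (\<lambda>z. w n z - u z) + f u"
      using add[OF mem u] by simp
    then show ?thesis using C[OF mem] w_mem(2)[of n] by linarith
  qed
  moreover have "(\<lambda>n. C * sqrt (energy (\<lambda>z. w n z - u z))) \<longlonglongrightarrow> C * sqrt 0"
    by (intro tendsto_intros conv)
  ultimately have "c - f u \<le> C * sqrt 0"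
    by (intro LIMSEQ_le_const) auto
  then show ?thesis by simp
qed

text \<open>
  If \<open>f (s n)\<close> exceeded \<open>f u + e\<close> infinitely often, the preceding lemma for that subsequence would
  give \<open>f u + e \<le> f u\<close>. The same for \<open>- f\<close> bounds \<open>f (s n)\<close> from below.
\<close>

lemma pointwise_imp_weakly_converges:
  assumes s: "\<And>n. s n \<in> X" "\<And>n. energy (s n) \<le> B"
    and lim: "\<And>z. (\<lambda>n. s n z) \<longlonglongrightarrow> u z"
  shows "weakly_converges X (\<lambda>u. sqrt (energy u)) s u"
  unfolding weakly_converges_def
proof (intro allI impI)
  have upper: "eventually (\<lambda>n. f (s n) < f u + e) sequentially"
    if f: "bounded_functional X (\<lambda>u. sqrt (energy u)) f" and "0 < e" for f and e :: real
  proof (rule ccontr)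
    assume "\<not> ?thesis"
    then have "infinite {n. f u + e \<le> f (s n)}"
      by (simp add: not_eventually not_less frequently_cofinite flip: cofinite_eq_sequentially)
    then obtain r :: "nat \<Rightarrow> nat" where r: "strict_mono r" "\<And>n. f u + e \<le> f (s (r n))"
      using infinite_enumerate by blast
    have "f u + e \<le> f u"
      by (rule functional_lower_bound_at_limit[where s = "s \<circ> r" and B = B])
        (use s r f LIMSEQ_subseq_LIMSEQ[OF lim r(1)] in \<open>auto simp: o_def\<close>)
    with \<open>0 < e\<close> show False by simp
  qed
  fix f assume f: "bounded_functional X (\<lambda>u. sqrt (energy u)) f"
  have neg: "bounded_functional X (\<lambda>u. sqrt (energy u)) (\<lambda>v. - f v)"
    using f unfolding bounded_functional_def by (auto simp: algebra_simps)
  show "(\<lambda>k. f (s k)) \<longlonglongrightarrow> f u"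
  proof (rule tendstoI)
    fix e :: real assume "0 < e"
    show "eventually (\<lambda>k. dist (f (s k)) (f u) < e) sequentially"
      using upper[OF f \<open>0 < e\<close>] upper[OF neg \<open>0 < e\<close>]
      by eventually_elim (auto simp: dist_real_def)
  qed
qed

end

section \<open>The energy of a weighted graph\<close>

text \<open>
  The potential \<open>b = 1\<close> gives the squared \<open>H1\<close> norm, and \<open>b = a + 1\<close> the squared norm of \<open>\<H>\<close>.
\<close>

definition energy_density ::
  "('v \<times> 'v) set \<Rightarrow> ('v \<Rightarrow> 'v \<Rightarrow> real) \<Rightarrow> ('v \<Rightarrow> real) \<Rightarrow> ('v \<Rightarrow> real)
    \<Rightarrow> ('v \<Rightarrow> real) \<Rightarrow> 'v \<Rightarrow> real" where
  "energy_density E \<omega> \<mu> b u x = \<mu> x * (Gam E \<omega> \<mu> u u x + b x * (u x)\<^sup>2)"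

locale weighted_graph =
  fixes E :: "('v \<times> 'v) set" and \<omega> :: "'v \<Rightarrow> 'v \<Rightarrow> real" and \<mu> :: "'v \<Rightarrow> real"
    and \<mu>min :: real
  assumes sym: "sym E" and locally_finite: "locally_finite_graph E"
    and weight_pos: "(x, y) \<in> E \<Longrightarrow> 0 < \<omega> x y"
    and \<mu>min_pos: "0 < \<mu>min" and \<mu>_ge: "\<mu>min \<le> \<mu> x"
begin

lemma \<mu>_pos: "0 < \<mu> x"
  using \<mu>min_pos \<mu>_ge[of x] by linarith

lemma energy_density_eq:
  "energy_density E \<omega> \<mu> b u x
     = (\<Sum>y\<in>E `` {x}. \<omega> x y * (u y - u x)\<^sup>2) / 2 + \<mu> x * b x * (u x)\<^sup>2"
  using \<mu>_pos[of x] unfolding energy_density_def Gam_def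
  by (simp add: distrib_left power2_eq_square mult.assoc)

lemma Gam_nonneg: "0 \<le> Gam E \<omega> \<mu> u u x"
  using \<mu>_pos[of x] weight_pos
  unfolding Gam_def mult.assoc power2_eq_square[symmetric]
  by (intro mult_nonneg_nonneg sum_nonneg) (auto simp: less_imp_le)

lemma quadratic_density_energy_density:
  assumes b: "\<And>x. 0 \<le> b x"
  shows "quadratic_density (energy_density E \<omega> \<mu> b)"
proof
  fix u v :: "'v \<Rightarrow> real" and x
  show "0 \<le> energy_density E \<omega> \<mu> b u x"
    unfolding energy_density_def using \<mu>_pos[of x] Gam_nonneg[of u x] b[of x] by simp
  have "(\<Sum>y\<in>E `` {x}. \<omega> x y * ((u y + v y) - (u x + v x))\<^sup>2)
      + (\<Sum>y\<in>E `` {x}. \<omega> x y * ((u y - v y) - (u x - v x))\<^sup>2)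
      = 2 * (\<Sum>y\<in>E `` {x}. \<omega> x y * (u y - u x)\<^sup>2)
      + 2 * (\<Sum>y\<in>E `` {x}. \<omega> x y * (v y - v x)\<^sup>2)"
    unfolding sum_distrib_left sum.distrib[symmetric]
    by (rule sum.cong) (auto simp: power2_eq_square algebra_simps)
  moreover have "\<mu> x * b x * (u x + v x)\<^sup>2 + \<mu> x * b x * (u x - v x)\<^sup>2
      = 2 * (\<mu> x * b x * (u x)\<^sup>2) + 2 * (\<mu> x * b x * (v x)\<^sup>2)"
    by (simp add: power2_eq_square algebra_simps)
  ultimately show "energy_density E \<omega> \<mu> b (\<lambda>z. u z + v z) x
      + energy_density E \<omega> \<mu> b (\<lambda>z. u z - v z) x
      = 2 * energy_density E \<omega> \<mu> b u x + 2 * energy_density E \<omega> \<mu> b v x"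
    unfolding energy_density_eq by argo
next
  fix c :: real and u :: "'v \<Rightarrow> real" and x
  show "energy_density E \<omega> \<mu> b (\<lambda>z. c * u z) x = c\<^sup>2 * energy_density E \<omega> \<mu> b u x"
    unfolding energy_density_eq
    by (simp add: right_diff_distrib[symmetric] power_mult_distrib sum_distrib_left
        distrib_left mult.left_commute)
next
  fix s :: "nat \<Rightarrow> 'v \<Rightarrow> real" and u :: "'v \<Rightarrow> real" and x
  assume "\<And>z. (\<lambda>n. s n z) \<longlonglongrightarrow> u z"
  then show "(\<lambda>n. energy_density E \<omega> \<mu> b (s n) x) \<longlonglongrightarrow> energy_density E \<omega> \<mu> b u x"
    unfolding energy_density_eq by (intro tendsto_intros) auto
qed

sublocale sobolev: quadratic_density "energy_density E \<omega> \<mu> (\<lambda>_. 1)"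
  by (rule quadratic_density_energy_density) simp

lemma H1_norm_eq: "H1_norm E \<omega> \<mu> u = sqrt (sobolev.energy u)"
  by (simp add: H1_norm_def vint_def sobolev.energy_def energy_density_def)

text \<open>
  The density of \<open>u\<close> vanishes except on the support of \<open>u\<close> and at the neighbours of the support,
  which are finitely many. Symmetry of \<open>E\<close> is what bounds the vertices that have a neighbour in the
  support.
\<close>

lemma Cc_finite_energy:
  assumes "u \<in> Cc"
  shows "sobolev.finite_energy u"
  unfolding sobolev.finite_energy_def
proof (rule finite_nonzero_values_imp_summable_on)
  let ?S = "{x. u x \<noteq> 0}"
  have supp: "x \<in> ?S \<union> (\<Union>y\<in>?S. E `` {y})"
    if nz: "energy_density E \<omega> \<mu> (\<lambda>_. 1) u x \<noteq> 0" for x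
  proof (rule ccontr)
    assume x: "\<not> ?thesis"
    then have "u y = 0" if "(x, y) \<in> E" for y
      using that sym by (auto dest: symD)
    with x have "energy_density E \<omega> \<mu> (\<lambda>_. 1) u x = 0"
      unfolding energy_density_eq by simp
    with nz show False ..
  qed
  have "finite (?S \<union> (\<Union>y\<in>?S. E `` {y}))"
    using assms locally_finite unfolding Cc_def locally_finite_graph_def by auto
  then show "finite {x \<in> UNIV. energy_density E \<omega> \<mu> (\<lambda>_. 1) u x \<noteq> 0}"
    by (rule rev_finite_subset) (use supp in blast)
qed

lemma sobolev_density_ge: "\<mu> x * (u x)\<^sup>2 \<le> energy_density E \<omega> \<mu> (\<lambda>_. 1) u x"
  using mult_left_mono[of "(u x)\<^sup>2" "Gam E \<omega> \<mu> u u x + (u x)\<^sup>2" "\<mu> x"]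
    Gam_nonneg[of u x] \<mu>_pos[of x]
  unfolding energy_density_def by simp

lemma pointwise_le_sobolev_energy:
  assumes "sobolev.finite_energy u"
  shows "(u x)\<^sup>2 \<le> sobolev.energy u / \<mu>min"
proof -
  have "\<mu>min * (u x)\<^sup>2 \<le> \<mu> x * (u x)\<^sup>2"
    using \<mu>_ge by (intro mult_right_mono) auto
  also have "\<dots> \<le> sobolev.energy u"
    using sobolev_density_ge sobolev.density_le_energy[OF assms] by (rule order_trans)
  finally show ?thesis using \<mu>min_pos by (simp add: field_simps)
qed

lemma pointwise_limit_of_energy_limit:
  assumes fin: "\<And>n. sobolev.finite_energy (\<lambda>z. s n z - u z)"
    and conv: "(\<lambda>n. sobolev.energy (\<lambda>z. s n z - u z)) \<longlonglongrightarrow> 0"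
  shows "(\<lambda>n. s n x) \<longlonglongrightarrow> u x"
proof -
  have "(\<lambda>n. sobolev.energy (\<lambda>z. s n z - u z) / \<mu>min) \<longlonglongrightarrow> 0"
    using tendsto_divide[OF conv tendsto_const, of \<mu>min] \<mu>min_pos by simp
  then have "(\<lambda>n. (s n x - u x)\<^sup>2) \<longlonglongrightarrow> 0"
    by (rule Lim_null_comparison[rotated])
      (auto intro!: always_eventually pointwise_le_sobolev_energy[OF fin])
  from tendsto_real_sqrt[OF this] have "(\<lambda>n. s n x - u x) \<longlonglongrightarrow> 0"
    by (simp add: tendsto_rabs_zero_iff)
  then show ?thesis by (rule LIM_zero_cancel)
qed

section \<open>The Sobolev space\<close>

text \<open>
  This replaces Cauchy sequences by a condition on one function at a time, which makes linearity
  and completeness of \<open>H1\<close> short. Pointwise convergence of the approximants, demanded by the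
  definition of \<open>H1\<close>, comes for free since the energy controls point values.
\<close>

lemma H1_iff_approximable:
  "u \<in> H1 E \<omega> \<mu> \<longleftrightarrow> sobolev.finite_energy u
     \<and> (\<forall>e>0. \<exists>\<phi>\<in>Cc. sobolev.energy (\<lambda>z. \<phi> z - u z) < e)"
    (is "?H1 \<longleftrightarrow> ?approx")
proof
  assume ?H1
  then obtain \<phi> where \<phi>: "\<And>n. \<phi> n \<in> Cc"
    and Cau: "\<And>e. e > 0 \<Longrightarrow>
      \<exists>N. \<forall>m\<ge>N. \<forall>n\<ge>N. sqrt (sobolev.energy (\<lambda>x. \<phi> m x - \<phi> n x)) < e"
    and lim: "\<And>x. (\<lambda>n. \<phi> n x) \<longlonglongrightarrow> u x"
    unfolding H1_def H1_norm_eq by blast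
  have "sobolev.energy_Cauchy \<phi>"
    unfolding sobolev.energy_Cauchy_def
    using Cau[OF real_sqrt_gt_zero] by simp
  note limit = sobolev.energy_Cauchy_limit[OF Cc_finite_energy[OF \<phi>] this lim]
  have "\<exists>\<phi>\<in>Cc. sobolev.energy (\<lambda>z. \<phi> z - u z) < e" if "e > 0" for e
    using eventually_happens'[OF sequentially_bot order_tendstoD(2)[OF limit(2) that]] \<phi>
    by blast
  with limit(1) show ?approx by blast
next
  assume approx: ?approx
  have "\<exists>\<phi>. \<phi> \<in> Cc \<and> sobolev.energy (\<lambda>z. \<phi> z - u z) < 1 / real (Suc n)" for n
  proof -
    have "0 < 1 / real (Suc n)" by simp
    with approx show ?thesis by blast
  qed
  then obtain \<phi> where \<phi>: "\<And>n. \<phi> n \<in> Cc"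
    and less: "\<And>n. sobolev.energy (\<lambda>z. \<phi> n z - u z) < 1 / real (Suc n)" by metis
  have fin: "sobolev.finite_energy (\<lambda>z. \<phi> n z - u z)" for n
    using approx Cc_finite_energy[OF \<phi>] by (blast intro: sobolev.finite_energy_diff)
  have conv: "(\<lambda>n. sobolev.energy (\<lambda>z. \<phi> n z - u z)) \<longlonglongrightarrow> 0"
  proof (rule Lim_null_comparison[OF _ LIMSEQ_inverse_real_of_nat])
    show "eventually (\<lambda>n. norm (sobolev.energy (\<lambda>z. \<phi> n z - u z)) \<le> inverse (real (Suc n)))
        sequentially"
      using less sobolev.energy_nonneg
      by (intro always_eventually) (simp add: inverse_eq_divide less_imp_le)
  qed
  have "\<exists>N. \<forall>m\<ge>N. \<forall>n\<ge>N. H1_norm E \<omega> \<mu> (\<lambda>x. \<phi> m x - \<phi> n x) < e" if "e > 0" for e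
  proof -
    from that have "0 < e\<^sup>2 / 4" by simp
    from order_tendstoD(2)[OF conv this] obtain N
      where N: "\<And>n. n \<ge> N \<Longrightarrow> sobolev.energy (\<lambda>z. \<phi> n z - u z) < e\<^sup>2 / 4"
      unfolding eventually_sequentially by blast
    have "H1_norm E \<omega> \<mu> (\<lambda>x. \<phi> m x - \<phi> n x) < e" if "m \<ge> N" "n \<ge> N" for m n
    proof -
      have "sobolev.energy (\<lambda>x. \<phi> m x - \<phi> n x) < e\<^sup>2"
        using sobolev.energy_diff_le[OF fin fin, of m n] N[OF that(1)] N[OF that(2)] by simp
      then show ?thesis
        unfolding H1_norm_eq using \<open>0 < e\<close> by (intro real_less_lsqrt) auto
    qed
    then show ?thesis by blast
  qed
  then show ?H1
    unfolding H1_def using \<phi> pointwise_limit_of_energy_limit[OF fin conv] by blast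
qed

lemma H1_add:
  assumes "u \<in> H1 E \<omega> \<mu>" and "v \<in> H1 E \<omega> \<mu>"
  shows "(\<lambda>z. u z + v z) \<in> H1 E \<omega> \<mu>"
  unfolding H1_iff_approximable
proof (intro conjI allI impI)
  have fin: "sobolev.finite_energy u" "sobolev.finite_energy v"
    using assms unfolding H1_iff_approximable by blast+
  then show "sobolev.finite_energy (\<lambda>z. u z + v z)"
    by (rule sobolev.finite_energy_add)
  fix e :: real assume "0 < e"
  then obtain \<phi> \<psi> where \<phi>: "\<phi> \<in> Cc" "sobolev.energy (\<lambda>z. \<phi> z - u z) < e / 4"
    and \<psi>: "\<psi> \<in> Cc" "sobolev.energy (\<lambda>z. \<psi> z - v z) < e / 4"
    using assms unfolding H1_iff_approximable by (metis zero_less_divide_iff zero_less_numeral)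
  have "sobolev.energy (\<lambda>z. (\<phi> z - u z) + (\<psi> z - v z)) < e"
    using sobolev.energy_add_le[of "\<lambda>z. \<phi> z - u z" "\<lambda>z. \<psi> z - v z"] \<phi> \<psi> fin
    by (simp add: sobolev.finite_energy_diff Cc_finite_energy)
  moreover have "(\<lambda>z. \<phi> z + \<psi> z) \<in> Cc"
    using \<phi>(1) \<psi>(1) unfolding Cc_def
    by (auto intro: finite_subset[of _ "{x. \<phi> x \<noteq> 0} \<union> {x. \<psi> x \<noteq> 0}"])
  ultimately show "\<exists>\<eta>\<in>Cc. sobolev.energy (\<lambda>z. \<eta> z - (u z + v z)) < e"
    by (intro bexI[of _ "\<lambda>z. \<phi> z + \<psi> z"]) (simp_all add: algebra_simps)
qed

lemma H1_scale:
  assumes "u \<in> H1 E \<omega> \<mu>"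
  shows "(\<lambda>z. c * u z) \<in> H1 E \<omega> \<mu>"
  unfolding H1_iff_approximable
proof (intro conjI allI impI)
  show "sobolev.finite_energy (\<lambda>z. c * u z)"
    using assms unfolding H1_iff_approximable by (blast intro: sobolev.finite_energy_scale)
  fix e :: real assume "0 < e"
  have pos: "0 < c\<^sup>2 + 1" by (simp add: add_nonneg_pos)
  with \<open>0 < e\<close> have "0 < e / (c\<^sup>2 + 1)" by simp
  then obtain \<phi> where \<phi>: "\<phi> \<in> Cc" "sobolev.energy (\<lambda>z. \<phi> z - u z) < e / (c\<^sup>2 + 1)"
    using assms unfolding H1_iff_approximable by blast
  have "c\<^sup>2 * sobolev.energy (\<lambda>z. \<phi> z - u z) \<le> (c\<^sup>2 + 1) * sobolev.energy (\<lambda>z. \<phi> z - u z)"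
    by (intro mult_right_mono sobolev.energy_nonneg) simp
  also have "\<dots> < e" using \<phi>(2) pos by (simp add: field_simps)
  finally have "sobolev.energy (\<lambda>z. c * (\<phi> z - u z)) < e"
    by (simp add: sobolev.energy_scale)
  moreover have "(\<lambda>z. c * \<phi> z) \<in> Cc"
    using \<phi>(1) unfolding Cc_def by (auto intro: rev_finite_subset)
  ultimately show "\<exists>\<eta>\<in>Cc. sobolev.energy (\<lambda>z. \<eta> z - c * u z) < e"
    by (intro bexI[of _ "\<lambda>z. c * \<phi> z"]) (simp_all add: algebra_simps)
qed

lemma H1_complete:
  assumes s: "\<And>n. s n \<in> H1 E \<omega> \<mu>" and Cau: "sobolev.energy_Cauchy s"
    and lim: "\<And>z. (\<lambda>n. s n z) \<longlonglongrightarrow> u z"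
  shows "u \<in> H1 E \<omega> \<mu>"
  unfolding H1_iff_approximable
proof (intro conjI allI impI)
  have fin: "sobolev.finite_energy (s n)" for n
    using s unfolding H1_iff_approximable by blast
  note limit = sobolev.energy_Cauchy_limit[OF fin Cau lim]
  show "sobolev.finite_energy u" by (rule limit)
  fix e :: real assume "0 < e"
  then have "0 < e / 4" by simp
  from eventually_happens'[OF sequentially_bot order_tendstoD(2)[OF limit(2) this]]
  obtain n where n: "sobolev.energy (\<lambda>z. s n z - u z) < e / 4" ..
  obtain \<phi> where \<phi>: "\<phi> \<in> Cc" "sobolev.energy (\<lambda>z. \<phi> z - s n z) < e / 4"
    using s[of n] \<open>0 < e / 4\<close> unfolding H1_iff_approximable by blast
  have "sobolev.energy (\<lambda>z. (\<phi> z - s n z) + (s n z - u z)) < e"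
    using sobolev.energy_add_le[of "\<lambda>z. \<phi> z - s n z" "\<lambda>z. s n z - u z"] n \<phi> fin limit(1)
    by (simp add: sobolev.finite_energy_diff Cc_finite_energy)
  with \<phi>(1) show "\<exists>\<phi>\<in>Cc. sobolev.energy (\<lambda>z. \<phi> z - u z) < e"
    by (intro bexI[of _ \<phi>]) simp_all
qed

section \<open>Embedding of the square-summable functions\<close>

text \<open>
  With \<open>S\<close> the squared \<open>L2\<close> norm of \<open>v\<close> and \<open>t = sqrt (S / \<mu>min)\<close>, every value satisfies
  \<open>\<bar>v x\<bar> \<le> t\<close>. This is the claim for \<open>p = \<infinity>\<close>. For finite \<open>p\<close> it gives the interpolation
  \<open>\<bar>v x\<bar> powr p \<le> t powr (p - 2) * (v x)\<^sup>2\<close>, whose integral is at most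
  \<open>t powr (p - 2) * S = \<mu>min * t powr p\<close>.
\<close>

lemma Lp_embedding_of_L2:
  assumes p: "(2::ereal) \<le> p"
  obtains C where "\<And>v. vintegrable \<mu> (\<lambda>x. (v x)\<^sup>2) \<Longrightarrow>
    v \<in> Lp \<mu> p \<and> 0 \<le> Lp_norm \<mu> p v \<and> Lp_norm \<mu> p v \<le> C * sqrt (vint \<mu> (\<lambda>x. (v x)\<^sup>2))"
proof -
  have sup: "\<bar>v x\<bar> \<le> sqrt (vint \<mu> (\<lambda>x. (v x)\<^sup>2) / \<mu>min)"
    if "vintegrable \<mu> (\<lambda>x. (v x)\<^sup>2)" for v x
  proof -
    have "\<mu>min * (v x)\<^sup>2 \<le> \<mu> x * (v x)\<^sup>2"
      using \<mu>_ge by (intro mult_right_mono) auto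
    also have "\<dots> \<le> vint \<mu> (\<lambda>x. (v x)\<^sup>2)"
      using finite_sum_le_infsum[of "\<lambda>x. \<mu> x * (v x)\<^sup>2" UNIV "{x}"] that \<mu>_pos
      unfolding vint_def vintegrable_def by (simp add: less_imp_le)
    finally have "(v x)\<^sup>2 \<le> vint \<mu> (\<lambda>x. (v x)\<^sup>2) / \<mu>min"
      using \<mu>min_pos by (simp add: field_simps)
    then show ?thesis using real_sqrt_le_mono by fastforce
  qed
  show ?thesis
  proof (cases "p = \<infinity>")
    case True
    show ?thesis
    proof (rule that[of "1 / sqrt \<mu>min"], intro conjI)
      fix v :: "'v \<Rightarrow> real" assume v: "vintegrable \<mu> (\<lambda>x. (v x)\<^sup>2)"
      have bdd: "bdd_above (range (\<lambda>x. \<bar>v x\<bar>))"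
        by (rule bdd_aboveI2) (rule sup[OF v])
      with True show "v \<in> Lp \<mu> p" by (simp add: Lp_def)
      show "0 \<le> Lp_norm \<mu> p v"
        using True cSUP_upper2[OF bdd, of undefined 0] by (simp add: Lp_norm_def)
      show "Lp_norm \<mu> p v \<le> 1 / sqrt \<mu>min * sqrt (vint \<mu> (\<lambda>x. (v x)\<^sup>2))"
        using True sup[OF v] by (auto simp: Lp_norm_def real_sqrt_divide intro!: cSUP_least)
    qed
  next
    case False
    with p obtain r where r: "p = ereal r" "2 \<le> r"
      by (cases p) auto
    show ?thesis
    proof (rule that[of "\<mu>min powr (1 / r) / sqrt \<mu>min"], intro conjI)
      fix v :: "'v \<Rightarrow> real" assume v: "vintegrable \<mu> (\<lambda>x. (v x)\<^sup>2)"
      define S where "S = vint \<mu> (\<lambda>x. (v x)\<^sup>2)"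
      define t where "t = sqrt (S / \<mu>min)"
      have S0: "0 \<le> S"
        unfolding S_def vint_def using \<mu>_pos by (intro infsum_nonneg) (simp add: less_imp_le)
      then have t0: "0 \<le> t" and t2: "\<mu>min * t\<^sup>2 = S"
        using \<mu>min_pos unfolding t_def by simp_all
      have le: "\<bar>v x\<bar> powr r \<le> t powr (r - 2) * (v x)\<^sup>2" for x
      proof -
        have "\<bar>v x\<bar> powr r = \<bar>v x\<bar> powr (r - 2) * (v x)\<^sup>2"
          using powr_add[of "\<bar>v x\<bar>" "r - 2" 2] by simp
        also have "\<dots> \<le> t powr (r - 2) * (v x)\<^sup>2"
          using sup[OF v, of x] r unfolding t_def S_def
          by (intro mult_right_mono powr_mono2) auto
        finally show ?thesis .
      qed
      have le': "\<mu> x * \<bar>v x\<bar> powr r \<le> t powr (r - 2) * (\<mu> x * (v x)\<^sup>2)" for x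
        using mult_left_mono[OF le[of x] less_imp_le[OF \<mu>_pos[of x]]]
        by (simp add: mult.left_commute)
      have summ: "(\<lambda>x. t powr (r - 2) * (\<mu> x * (v x)\<^sup>2)) summable_on UNIV"
        using v unfolding vintegrable_def by (rule summable_on_cmult_right)
      have int: "(\<lambda>x. \<mu> x * \<bar>v x\<bar> powr r) summable_on UNIV"
        by (rule summable_on_comparison_test[OF summ le']) (simp add: \<mu>_pos less_imp_le)
      then show "v \<in> Lp \<mu> p" using r by (simp add: Lp_def vintegrable_def)
      have int0: "0 \<le> vint \<mu> (\<lambda>x. \<bar>v x\<bar> powr r)"
        unfolding vint_def by (intro infsum_nonneg) (simp add: \<mu>_pos less_imp_le)
      show "0 \<le> Lp_norm \<mu> p v" using r by (simp add: Lp_norm_def)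
      have "vint \<mu> (\<lambda>x. \<bar>v x\<bar> powr r) \<le> (\<Sum>\<^sub>\<infinity>x. t powr (r - 2) * (\<mu> x * (v x)\<^sup>2))"
        unfolding vint_def by (intro infsum_mono int summ le')
      also have "\<dots> = t powr (r - 2) * S"
        unfolding S_def vint_def by (rule infsum_cmult_right')
      also have "\<dots> = \<mu>min * t powr r"
        using powr_add[of t "r - 2" 2] t0 unfolding t2[symmetric] by simp
      finally have "vint \<mu> (\<lambda>x. \<bar>v x\<bar> powr r) powr (1 / r) \<le> (\<mu>min * t powr r) powr (1 / r)"
        using r int0 by (intro powr_mono2) auto
      also have "\<dots> = \<mu>min powr (1 / r) * t"
        using r t0 \<mu>min_pos by (simp add: powr_mult powr_powr)
      finally show "Lp_norm \<mu> p v \<le> \<mu>min powr (1 / r) / sqrt \<mu>min * sqrt (vint \<mu> (\<lambda>x. (v x)\<^sup>2))"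
        using r unfolding t_def S_def by (simp add: Lp_norm_def real_sqrt_divide)
    qed
  qed
qed

end

section \<open>Confining potentials\<close>

locale confining_potential = weighted_graph E \<omega> \<mu> \<mu>min
  for E :: "('v \<times> 'v) set" and \<omega> and \<mu> and \<mu>min +
  fixes a :: "'v \<Rightarrow> real" and a0 :: real
  assumes a0: "-1 < a0" "a0 < 0" and a_ge: "a0 \<le> a x"
    and sublevel_volume: "0 < M \<Longrightarrow> \<mu> summable_on {x. a x \<le> M}"
begin

lemma finite_sublevel:
  assumes "0 < M"
  shows "finite {x. a x \<le> M}"
proof (rule ccontr)
  let ?D = "{x. a x \<le> M}"
  assume "infinite ?D"
  obtain k where k: "infsum \<mu> ?D < real k * \<mu>min"
    using reals_Archimedean3[OF \<mu>min_pos] by blast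
  obtain F where F: "finite F" "card F = k" "F \<subseteq> ?D"
    using infinite_arbitrarily_large[OF \<open>infinite ?D\<close>] by blast
  have "real k * \<mu>min \<le> sum \<mu> F"
    using sum_bounded_below[of F \<mu>min \<mu>] \<mu>_ge F(2) by auto
  also have "\<dots> \<le> infsum \<mu> ?D"
    using F \<mu>_pos by (intro finite_sum_le_infsum sublevel_volume assms) (auto simp: less_imp_le)
  finally show False using k by simp
qed

text \<open>
  Needed to extract pointwise convergent subsequences by a diagonal argument.
\<close>

lemma countable_vertices: "countable (UNIV :: 'v set)"
proof -
  have "\<exists>n. a x \<le> real (Suc n)" for x
  proof -
    obtain n where "a x \<le> real n" using real_arch_simple by blast
    then have "a x \<le> real (Suc n)" by simp
    then show ?thesis ..
  qed
  then have cover: "UNIV \<subseteq> (\<Union>n. {x. a x \<le> real (Suc n)})"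
    by blast
  have "countable {x. a x \<le> real (Suc n)}" for n
    by (intro countable_finite finite_sublevel) simp
  then have "countable (\<Union>n. {x. a x \<le> real (Suc n)})"
    by simp
  with cover show ?thesis by (rule countable_subset)
qed

sublocale schroedinger: quadratic_density "energy_density E \<omega> \<mu> (\<lambda>x. a x + 1)"
proof (rule quadratic_density_energy_density)
  show "0 \<le> a x + 1" for x using a0 a_ge[of x] by linarith
qed

lemma Hsp_norm_eq: "Hsp_norm E \<omega> \<mu> a u = sqrt (schroedinger.energy u)"
  by (simp add: Hsp_norm_def Hsp_inner_def vint_def schroedinger.energy_def energy_density_def
      power2_eq_square mult.assoc)

text \<open>
  The factor \<open>1 / (1 + a0)\<close> serves the gradient part as well as the potential part because
  \<open>a0 < 0\<close> makes it at least 1.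
\<close>

lemma sobolev_density_le:
  "energy_density E \<omega> \<mu> (\<lambda>_. 1) u x
     \<le> 1 / (1 + a0) * energy_density E \<omega> \<mu> (\<lambda>x. a x + 1) u x"
proof -
  have "(1 + a0) * Gam E \<omega> \<mu> u u x \<le> 1 * Gam E \<omega> \<mu> u u x"
    using a0 Gam_nonneg by (intro mult_right_mono) auto
  moreover have "(1 + a0) * (u x)\<^sup>2 \<le> (a x + 1) * (u x)\<^sup>2"
    using a_ge[of x] by (intro mult_right_mono) auto
  ultimately have "(1 + a0) * (Gam E \<omega> \<mu> u u x + 1 * (u x)\<^sup>2)
      \<le> Gam E \<omega> \<mu> u u x + (a x + 1) * (u x)\<^sup>2"
    by (simp add: distrib_left)
  then have "\<mu> x * ((1 + a0) * (Gam E \<omega> \<mu> u u x + 1 * (u x)\<^sup>2))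
      \<le> energy_density E \<omega> \<mu> (\<lambda>x. a x + 1) u x"
    unfolding energy_density_def using \<mu>_pos[of x] by (intro mult_left_mono) auto
  then show ?thesis
    unfolding energy_density_def using a0 by (simp add: field_simps)
qed

lemma sobolev_le_schroedinger:
  assumes "schroedinger.finite_energy u"
  shows "sobolev.finite_energy u"
    and "sobolev.energy u \<le> 1 / (1 + a0) * schroedinger.energy u"
proof -
  have summ: "(\<lambda>x. 1 / (1 + a0) * energy_density E \<omega> \<mu> (\<lambda>x. a x + 1) u x) summable_on UNIV"
    using assms unfolding schroedinger.finite_energy_def by (rule summable_on_cmult_right)
  show fin: "sobolev.finite_energy u"
    unfolding sobolev.finite_energy_def
    by (rule summable_on_comparison_test[OF summ sobolev_density_le sobolev.nonneg])
  show "sobolev.energy u \<le> 1 / (1 + a0) * schroedinger.energy u"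
    using infsum_mono[OF fin[unfolded sobolev.finite_energy_def] summ sobolev_density_le]
    unfolding sobolev.energy_def schroedinger.energy_def by (simp only: infsum_cmult_right')
qed

text \<open>
  On \<open>H1\<close> the two densities differ by \<open>\<mu> a u\<^sup>2\<close> and the one for \<open>b = 1\<close> is already
  summable, so integrability of \<open>a u\<^sup>2\<close> and finiteness of the energy of \<open>\<H>\<close> are the same condition.
\<close>

lemma Hsp_iff: "u \<in> Hsp E \<omega> \<mu> a \<longleftrightarrow> u \<in> H1 E \<omega> \<mu> \<and> schroedinger.finite_energy u"
proof -
  have "vintegrable \<mu> (\<lambda>x. a x * (u x)\<^sup>2) \<longleftrightarrow> schroedinger.finite_energy u"
    if "u \<in> H1 E \<omega> \<mu>"
  proof -
    have fin: "energy_density E \<omega> \<mu> (\<lambda>_. 1) u summable_on UNIV"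
      using that unfolding H1_iff_approximable sobolev.finite_energy_def by blast
    have split: "energy_density E \<omega> \<mu> (\<lambda>x. a x + 1) u x
        = energy_density E \<omega> \<mu> (\<lambda>_. 1) u x + \<mu> x * (a x * (u x)\<^sup>2)" for x
      by (simp add: energy_density_def algebra_simps)
    show ?thesis
    proof
      assume "vintegrable \<mu> (\<lambda>x. a x * (u x)\<^sup>2)"
      from summable_on_add[OF fin this[unfolded vintegrable_def]]
      show "schroedinger.finite_energy u"
        unfolding schroedinger.finite_energy_def by (simp add: split cong: summable_on_cong)
    next
      assume "schroedinger.finite_energy u"
      from summable_on_add[OF this[unfolded schroedinger.finite_energy_def]
          summable_on_cmult_right[OF fin, of "-1"]]
      show "vintegrable \<mu> (\<lambda>x. a x * (u x)\<^sup>2)"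
        unfolding vintegrable_def by (simp add: split)
    qed
  qed
  then show ?thesis unfolding Hsp_def by blast
qed

text \<open>
  Completeness of \<open>\<H>\<close>: a Cauchy sequence in \<open>\<H>\<close> is Cauchy in \<open>H1\<close>, which puts the pointwise limit
  in \<open>H1\<close>; its energy in \<open>\<H>\<close> is finite by lower semicontinuity.
\<close>

sublocale schroedinger: energy_space "energy_density E \<omega> \<mu> (\<lambda>x. a x + 1)" "Hsp E \<omega> \<mu> a"
proof
  show "schroedinger.finite_energy u" if "u \<in> Hsp E \<omega> \<mu> a" for u
    using that Hsp_iff by blast
  show "(\<lambda>z. u z + v z) \<in> Hsp E \<omega> \<mu> a" if "u \<in> Hsp E \<omega> \<mu> a" "v \<in> Hsp E \<omega> \<mu> a" for u v
    using that unfolding Hsp_iff by (blast intro: H1_add schroedinger.finite_energy_add)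
  show "(\<lambda>z. c * u z) \<in> Hsp E \<omega> \<mu> a" if "u \<in> Hsp E \<omega> \<mu> a" for c u
    using that unfolding Hsp_iff by (blast intro: H1_scale schroedinger.finite_energy_scale)
  fix s u
  assume s: "\<And>n. s n \<in> Hsp E \<omega> \<mu> a" and Cau: "schroedinger.energy_Cauchy s"
    and lim: "\<And>z. (\<lambda>n. s n z) \<longlonglongrightarrow> u z"
  have fin: "schroedinger.finite_energy (s n)" for n using s Hsp_iff by blast
  have "sobolev.energy_Cauchy s"
    unfolding sobolev.energy_Cauchy_def
  proof (intro allI impI)
    fix e :: real assume "0 < e"
    with a0 have "0 < (1 + a0) * e" by simp
    then obtain N where
      N: "\<And>m n. m \<ge> N \<Longrightarrow> n \<ge> N \<Longrightarrow> schroedinger.energy (\<lambda>x. s m x - s n x) < (1 + a0) * e"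
      using Cau unfolding schroedinger.energy_Cauchy_def by blast
    have "sobolev.energy (\<lambda>x. s m x - s n x) < e" if "m \<ge> N" "n \<ge> N" for m n
    proof -
      have "1 / (1 + a0) * schroedinger.energy (\<lambda>x. s m x - s n x) < e"
        using N[OF that] a0 by (simp add: field_simps)
      with sobolev_le_schroedinger(2)[OF schroedinger.finite_energy_diff[OF fin fin]]
      show ?thesis by (rule le_less_trans)
    qed
    then show "\<exists>N. \<forall>m\<ge>N. \<forall>n\<ge>N. sobolev.energy (\<lambda>x. s m x - s n x) < e" by blast
  qed
  with s lim have "u \<in> H1 E \<omega> \<mu>"
    unfolding Hsp_iff by (blast intro: H1_complete)
  with schroedinger.energy_Cauchy_limit(1)[OF fin Cau lim]
  show "u \<in> Hsp E \<omega> \<mu> a" unfolding Hsp_iff by blast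
qed

lemma L2_le_schroedinger:
  assumes "schroedinger.finite_energy u"
  shows "vintegrable \<mu> (\<lambda>x. (u x)\<^sup>2)"
    and "vint \<mu> (\<lambda>x. (u x)\<^sup>2) \<le> 1 / (1 + a0) * schroedinger.energy u"
proof -
  note fin = sobolev_le_schroedinger(1)[OF assms, unfolded sobolev.finite_energy_def]
  show int: "vintegrable \<mu> (\<lambda>x. (u x)\<^sup>2)"
    unfolding vintegrable_def
    by (rule summable_on_comparison_test[OF fin sobolev_density_ge])
      (simp add: \<mu>_pos less_imp_le)
  have "vint \<mu> (\<lambda>x. (u x)\<^sup>2) \<le> sobolev.energy u"
    unfolding vint_def sobolev.energy_def
    by (rule infsum_mono[OF int[unfolded vintegrable_def] fin sobolev_density_ge])
  with sobolev_le_schroedinger(2)[OF assms]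
  show "vint \<mu> (\<lambda>x. (u x)\<^sup>2) \<le> 1 / (1 + a0) * schroedinger.energy u" by linarith
qed

text \<open>
  Off the sublevel set, \<open>M * (u x)\<^sup>2 \<le> (a x + 1) * (u x)\<^sup>2\<close>. So the growth of the potential
  bounds the mass that can sit outside a finite set.
\<close>

lemma L2_tail:
  assumes fin: "schroedinger.finite_energy u" and M: "0 < M"
  shows "vint \<mu> (\<lambda>x. (u x)\<^sup>2)
    \<le> (\<Sum>x | a x \<le> M. \<mu> x * (u x)\<^sup>2) + schroedinger.energy u / M"
proof -
  let ?D = "{x. a x \<le> M}"
  let ?q = "energy_density E \<omega> \<mu> (\<lambda>x. a x + 1) u"
  have le: "\<mu> x * (u x)\<^sup>2 \<le> (if x \<in> ?D then \<mu> x * (u x)\<^sup>2 else 0) + 1 / M * ?q x" for x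
  proof (cases "x \<in> ?D")
    case True
    then show ?thesis using schroedinger.nonneg[of u x] M by simp
  next
    case False
    then have "M * (u x)\<^sup>2 \<le> (a x + 1) * (u x)\<^sup>2"
      by (intro mult_right_mono) auto
    then have "M * (u x)\<^sup>2 \<le> Gam E \<omega> \<mu> u u x + (a x + 1) * (u x)\<^sup>2"
      using Gam_nonneg[of u x] by linarith
    then have "\<mu> x * (M * (u x)\<^sup>2) \<le> ?q x"
      unfolding energy_density_def using \<mu>_pos[of x] by (intro mult_left_mono) auto
    then show ?thesis using False M by (simp add: field_simps)
  qed
  have D: "(\<lambda>x. if x \<in> ?D then \<mu> x * (u x)\<^sup>2 else 0) summable_on UNIV"
    by (rule finite_nonzero_values_imp_summable_on)
      (auto intro: finite_subset[OF _ finite_sublevel[OF M]])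
  have q: "(\<lambda>x. 1 / M * ?q x) summable_on UNIV"
    using fin unfolding schroedinger.finite_energy_def by (rule summable_on_cmult_right)
  have "vint \<mu> (\<lambda>x. (u x)\<^sup>2)
      \<le> (\<Sum>\<^sub>\<infinity>x. (if x \<in> ?D then \<mu> x * (u x)\<^sup>2 else 0) + 1 / M * ?q x)"
    unfolding vint_def using L2_le_schroedinger(1)[OF fin]
    by (intro infsum_mono summable_on_add D q le) (simp add: vintegrable_def)
  also have "\<dots> = (\<Sum>\<^sub>\<infinity>x. if x \<in> ?D then \<mu> x * (u x)\<^sup>2 else 0) + (\<Sum>\<^sub>\<infinity>x. 1 / M * ?q x)"
    by (rule infsum_add[OF D q])
  also have "(\<Sum>\<^sub>\<infinity>x. if x \<in> ?D then \<mu> x * (u x)\<^sup>2 else 0) = (\<Sum>\<^sub>\<infinity>x\<in>?D. \<mu> x * (u x)\<^sup>2)"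
    by (rule infsum_cong_neutral) auto
  also have "\<dots> = (\<Sum>x\<in>?D. \<mu> x * (u x)\<^sup>2)"
    by (rule infsum_finite[OF finite_sublevel[OF M]])
  also have "(\<Sum>\<^sub>\<infinity>x. 1 / M * ?q x) = schroedinger.energy u / M"
    unfolding schroedinger.energy_def by (subst infsum_cmult_right') simp
  finally show ?thesis .
qed

lemma pointwise_null_imp_L2_null:
  assumes fin: "\<And>n. schroedinger.finite_energy (v n)"
    and B: "\<And>n. schroedinger.energy (v n) \<le> B"
    and lim: "\<And>x. (\<lambda>n. v n x) \<longlonglongrightarrow> 0"
  shows "(\<lambda>n. vint \<mu> (\<lambda>x. (v n x)\<^sup>2)) \<longlonglongrightarrow> 0"
proof (rule LIMSEQ_I)
  fix e :: real assume "0 < e"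
  \<comment> \<open>Chosen so that the tail contributes less than \<open>e / 2\<close>.\<close>
  define M where "M = 2 * (\<bar>B\<bar> + 1) / e"
  have M: "0 < M" using \<open>0 < e\<close> unfolding M_def by (simp add: add_nonneg_pos)
  have BM: "B / M < e / 2"
  proof -
    have "M * (e / 2) = \<bar>B\<bar> + 1" using \<open>0 < e\<close> unfolding M_def by simp
    then have "B < e / 2 * M" by (simp add: mult.commute)
    with M show ?thesis by (simp add: pos_divide_less_eq)
  qed
  have "(\<lambda>n. \<Sum>x | a x \<le> M. \<mu> x * (v n x)\<^sup>2) \<longlonglongrightarrow> (\<Sum>x | a x \<le> M. \<mu> x * 0\<^sup>2)"
    by (intro tendsto_intros lim)
  then have "(\<lambda>n. \<Sum>x | a x \<le> M. \<mu> x * (v n x)\<^sup>2) \<longlonglongrightarrow> 0" by simp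
  from order_tendstoD(2)[OF this half_gt_zero[OF \<open>0 < e\<close>]] obtain N where
    N: "\<And>n. n \<ge> N \<Longrightarrow> (\<Sum>x | a x \<le> M. \<mu> x * (v n x)\<^sup>2) < e / 2"
    unfolding eventually_sequentially by blast
  have "norm (vint \<mu> (\<lambda>x. (v n x)\<^sup>2) - 0) < e" if "n \<ge> N" for n
  proof -
    have "schroedinger.energy (v n) / M \<le> B / M"
      using B M by (intro divide_right_mono) auto
    then have "vint \<mu> (\<lambda>x. (v n x)\<^sup>2) < e"
      using L2_tail[OF fin M, of n] N[OF that] BM by linarith
    moreover have "0 \<le> vint \<mu> (\<lambda>x. (v n x)\<^sup>2)"
      unfolding vint_def by (intro infsum_nonneg) (simp add: \<mu>_pos less_imp_le)
    ultimately show ?thesis by simp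
  qed
  then show "\<exists>N. \<forall>n\<ge>N. norm (vint \<mu> (\<lambda>x. (v n x)\<^sup>2) - 0) < e" by blast
qed

text \<open>
  The common source of both claims: one subsequence, convergent at every vertex, serves for the
  weak limit and for the limit in every \<open>Lp\<close>.
\<close>

lemma bounded_subsequence:
  assumes "bounded_seq_in (Hsp E \<omega> \<mu> a) (Hsp_norm E \<omega> \<mu> a) s"
  obtains r :: "nat \<Rightarrow> nat" and u B where "strict_mono r"
    and "\<And>n. s n \<in> Hsp E \<omega> \<mu> a" and "\<And>n. schroedinger.energy (s n) \<le> B"
    and "\<And>x. (\<lambda>n. s (r n) x) \<longlonglongrightarrow> u x" and "u \<in> Hsp E \<omega> \<mu> a"
proof -
  from assms obtain K where s: "\<And>n. s n \<in> Hsp E \<omega> \<mu> a"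
    and K: "\<And>n. sqrt (schroedinger.energy (s n)) \<le> K"
    unfolding bounded_seq_in_def Hsp_norm_eq by blast
  have B: "schroedinger.energy (s n) \<le> K\<^sup>2" for n
    using K[of n] by (rule sqrt_le_D)
  have fin: "schroedinger.finite_energy (s n)" for n
    using s Hsp_iff by blast
  define R where "R = sqrt (1 / (1 + a0) * K\<^sup>2 / \<mu>min)"
  have bound: "norm (s n x) \<le> R" for n x
  proof -
    have "(s n x)\<^sup>2 \<le> sobolev.energy (s n) / \<mu>min"
      by (rule pointwise_le_sobolev_energy[OF sobolev_le_schroedinger(1)[OF fin]])
    also have "sobolev.energy (s n) \<le> 1 / (1 + a0) * schroedinger.energy (s n)"
      by (rule sobolev_le_schroedinger(2)[OF fin])
    also have "\<dots> \<le> 1 / (1 + a0) * K\<^sup>2"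
      using a0 by (intro mult_left_mono B) auto
    finally have "(s n x)\<^sup>2 \<le> 1 / (1 + a0) * K\<^sup>2 / \<mu>min"
      using \<mu>min_pos by (simp add: divide_right_mono)
    then show ?thesis
      unfolding R_def using real_sqrt_le_mono by fastforce
  qed
  obtain r :: "nat \<Rightarrow> nat" where r: "strict_mono r"
    and ex: "\<And>x. x \<in> UNIV \<Longrightarrow> \<exists>l. (\<lambda>n. s (r n) x) \<longlonglongrightarrow> l"
  proof (rule function_convergent_subsequence[OF countable_vertices, of s R])
    show "norm (s n x) \<le> R" for n x by (rule bound)
  qed (rule that)
  define u where "u x = lim (\<lambda>n. s (r n) x)" for x
  have lim: "(\<lambda>n. s (r n) x) \<longlonglongrightarrow> u x" for x
    using ex[of x] unfolding u_def convergent_def[symmetric] by (simp only: convergent_LIMSEQ_iff UNIV_I)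
  have "u \<in> Hsp E \<omega> \<mu> a"
    by (rule schroedinger.midpoint_limit[of "\<lambda>n. s (r n)" "K\<^sup>2" u, OF s B lim])
  then show ?thesis by (rule that[OF r s B lim])
qed

theorem Hsp_weakly_precompact:
  "weakly_precompact (Hsp E \<omega> \<mu> a) (Hsp_norm E \<omega> \<mu> a)"
  unfolding weakly_precompact_def
proof (intro allI impI)
  fix s assume "bounded_seq_in (Hsp E \<omega> \<mu> a) (Hsp_norm E \<omega> \<mu> a) s"
  then obtain r :: "nat \<Rightarrow> nat" and u B where r: "strict_mono r"
    and s: "\<And>n. s n \<in> Hsp E \<omega> \<mu> a" and B: "\<And>n. schroedinger.energy (s n) \<le> B"
    and lim: "\<And>x. (\<lambda>n. s (r n) x) \<longlonglongrightarrow> u x" and u: "u \<in> Hsp E \<omega> \<mu> a"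
    by (rule bounded_subsequence) blast
  have "weakly_converges (Hsp E \<omega> \<mu> a) (Hsp_norm E \<omega> \<mu> a) (s \<circ> r) u"
    using schroedinger.pointwise_imp_weakly_converges[of "s \<circ> r" B u] s B lim
    by (simp add: o_def Hsp_norm_eq[abs_def])
  with r u show "\<exists>r u. strict_mono r \<and> u \<in> Hsp E \<omega> \<mu> a
      \<and> weakly_converges (Hsp E \<omega> \<mu> a) (Hsp_norm E \<omega> \<mu> a) (s \<circ> r) u" by blast
qed

theorem Hsp_compactly_embedded:
  assumes "(2::ereal) \<le> p"
  shows "compactly_embedded (Hsp E \<omega> \<mu> a) (Hsp_norm E \<omega> \<mu> a) (Lp \<mu> p) (Lp_norm \<mu> p)"
proof -
  obtain C where emb: "\<And>v. vintegrable \<mu> (\<lambda>x. (v x)\<^sup>2) \<Longrightarrow> v \<in> Lp \<mu> p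
      \<and> 0 \<le> Lp_norm \<mu> p v \<and> Lp_norm \<mu> p v \<le> C * sqrt (vint \<mu> (\<lambda>x. (v x)\<^sup>2))"
    using Lp_embedding_of_L2[OF assms] by blast
  have L2: "vintegrable \<mu> (\<lambda>x. (u x)\<^sup>2)" if "u \<in> Hsp E \<omega> \<mu> a" for u
    using that L2_le_schroedinger(1) Hsp_iff by blast
  show ?thesis
    unfolding compactly_embedded_def
  proof (intro conjI allI impI)
    show "Hsp E \<omega> \<mu> a \<subseteq> Lp \<mu> p" using emb L2 by blast
    have "Lp_norm \<mu> p u \<le> \<bar>C\<bar> * sqrt (1 / (1 + a0)) * Hsp_norm E \<omega> \<mu> a u"
      if u: "u \<in> Hsp E \<omega> \<mu> a" for u
    proof -
      have "Lp_norm \<mu> p u \<le> C * sqrt (vint \<mu> (\<lambda>x. (u x)\<^sup>2))"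
        using emb[OF L2[OF u]] by blast
      also have "\<dots> \<le> \<bar>C\<bar> * sqrt (vint \<mu> (\<lambda>x. (u x)\<^sup>2))"
        by (intro mult_right_mono) (auto simp: vint_def \<mu>_pos less_imp_le intro!: infsum_nonneg)
      also have "\<dots> \<le> \<bar>C\<bar> * sqrt (1 / (1 + a0) * schroedinger.energy u)"
        using u by (intro mult_left_mono real_sqrt_le_mono L2_le_schroedinger(2))
          (simp_all add: Hsp_iff)
      finally show ?thesis
        by (simp add: Hsp_norm_eq real_sqrt_mult real_sqrt_divide)
    qed
    then show "\<exists>C. \<forall>u\<in>Hsp E \<omega> \<mu> a. Lp_norm \<mu> p u \<le> C * Hsp_norm E \<omega> \<mu> a u" by blast
  next
    fix s assume "bounded_seq_in (Hsp E \<omega> \<mu> a) (Hsp_norm E \<omega> \<mu> a) s"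
    then obtain r :: "nat \<Rightarrow> nat" and u B where r: "strict_mono r"
      and s: "\<And>n. s n \<in> Hsp E \<omega> \<mu> a" and B: "\<And>n. schroedinger.energy (s n) \<le> B"
      and lim: "\<And>x. (\<lambda>n. s (r n) x) \<longlonglongrightarrow> u x" and u: "u \<in> Hsp E \<omega> \<mu> a"
      by (rule bounded_subsequence) blast
    define v where "v n = (\<lambda>x. s (r n) x - u x)" for n
    have v: "v n \<in> Hsp E \<omega> \<mu> a" for n
      unfolding v_def by (intro schroedinger.diff_mem s u)
    have "schroedinger.energy (v n) \<le> 2 * B + 2 * schroedinger.energy u" for n
      unfolding v_def
      using schroedinger.energy_diff_le[of "s (r n)" u] B[of "r n"] s u
      by (simp add: schroedinger.finite_energy)
    moreover have "(\<lambda>n. v n x) \<longlonglongrightarrow> 0" for x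
      unfolding v_def by (rule LIM_zero[OF lim])
    ultimately have "(\<lambda>n. vint \<mu> (\<lambda>x. (v n x)\<^sup>2)) \<longlonglongrightarrow> 0"
      using v by (intro pointwise_null_imp_L2_null) (auto simp: schroedinger.finite_energy)
    then have "(\<lambda>n. C * sqrt (vint \<mu> (\<lambda>x. (v n x)\<^sup>2))) \<longlonglongrightarrow> C * sqrt 0"
      by (intro tendsto_intros)
    then have "(\<lambda>n. C * sqrt (vint \<mu> (\<lambda>x. (v n x)\<^sup>2))) \<longlonglongrightarrow> 0" by simp
    then have "(\<lambda>n. Lp_norm \<mu> p (v n)) \<longlonglongrightarrow> 0"
      by (rule tendsto_sandwich[OF _ _ tendsto_const, rotated 2])
        (use emb[OF L2[OF v]] in \<open>auto intro: always_eventually\<close>)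
    with r u emb[OF L2] show "\<exists>r u. strict_mono r \<and> u \<in> Lp \<mu> p
        \<and> (\<lambda>k. Lp_norm \<mu> p (\<lambda>x. s (r k) x - u x)) \<longlonglongrightarrow> 0"
      unfolding v_def by blast
  qed
qed

end

theorem lemma3:
  fixes E :: "('v \<times> 'v) set"
    and \<omega> :: "'v \<Rightarrow> 'v \<Rightarrow> real"
    and \<mu> a :: "'v \<Rightarrow> real"
    and \<mu>min a0 :: real
  assumes "sym E" and "connected_graph E" and "locally_finite_graph E"
    and "\<And>x y. (x, y) \<in> E \<Longrightarrow> \<omega> x y > 0"
    and "\<And>x y. (x, y) \<in> E \<Longrightarrow> \<omega> x y = \<omega> y x"
    and "\<mu>min > 0" and "\<And>x. \<mu> x \<ge> \<mu>min"
    and A1: "-1 < a0" "a0 < 0" "\<And>x. a x \<ge> a0"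
    and A2: "\<And>M. M > 0 \<Longrightarrow> \<mu> summable_on {x. a x \<le> M}"
  shows "weakly_precompact (Hsp E \<omega> \<mu> a) (Hsp_norm E \<omega> \<mu> a) \<and>
    (\<forall>p :: ereal. 2 \<le> p \<longrightarrow>
       compactly_embedded (Hsp E \<omega> \<mu> a) (Hsp_norm E \<omega> \<mu> a) (Lp \<mu> p) (Lp_norm \<mu> p))"
proof -
  interpret confining_potential E \<omega> \<mu> \<mu>min a a0
    by unfold_locales (use assms in auto)
  show ?thesis
    using Hsp_weakly_precompact Hsp_compactly_embedded by blast
qed

end
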